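(* Let $(\Omega,\mu)$ be a finite measure space and let $J = \mathbb{N}$ or $J = (0,\infty)$. For every $t \in J$ let $\varphi_t\colon \Omega \to \Omega$ be a measurable mapping which is measure-preserving, meaning that $\mu(\varphi_t^{-1}(A)) = \mu(A)$ for all measurable sets $A \subseteq \Omega$, and assume that $\varphi_{t+s} = \varphi_t \circ \varphi_s$ for all $t,s \in J$. For each $t\in J$ denote by $T_t\colon L^1(\Omega,\mu) \to L^1(\Omega,\mu)$ the Frobenius-Perron operator associated with $\varphi_t$. If the semigroup $\mathcal{T} = (T_t)_{t \in J}$ is convergent with respect to the operator norm as $t\to\infty$, then $T_t = \mathrm{id}_{L^1(\Omega,\mu)}$ for all $t \in J$.
   Context: All spaces are real. $\mathbb{N} = \{1,2,\dots\}$. A measurable mapping $\varphi\colon\Omega\to\Omega$ is non-singular if $\mu(\varphi^{-1}(A))>0$ implies $\mu(A)>0$ for each measurable $A \subseteq \Omega$. For such $\varphi$ the associated Frobenius-Perron operator is the uniquely determined bounded linear operator $T\colon L^1(\Omega,\mu)\to L^1(\Omega,\mu)$ satisfying $\int_A Tf\,d\mu = \int_{\varphi^{-1}(A)} f\,d\mu$ for all $f \in L^1(\Omega,\mu)$ and every measurable $A\subseteq\Omega$. *)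

theory Defs
  imports "HOL-Analysis.Analysis"
begin

section \<open>The space $L^1$ of a measure\<close>

text \<open>
  There is no type of elements of $L^1(\Omega,\mu)$, since it would depend on the measure.
  We therefore take $L^1$ to be the set of classes of integrable real functions modulo equality
  almost everywhere, and define the vector space operations, the norm and the integral on
  classes through representatives.  The lemmas below show that the chosen representatives do
  not matter.
\<close>

definition ae_rel :: "'a measure \<Rightarrow> (('a \<Rightarrow> real) \<times> ('a \<Rightarrow> real)) set" where
  "ae_rel M = {(f, g). integrable M f \<and> integrable M g \<and> (AE x in M. f x = g x)}"

definition L1 :: "'a measure \<Rightarrow> ('a \<Rightarrow> real) set set" where
  "L1 M = {f. integrable M f} // ae_rel M"

definition L1_class :: "'a measure \<Rightarrow> ('a \<Rightarrow> real) \<Rightarrow> ('a \<Rightarrow> real) set" where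
  "L1_class M f = ae_rel M `` {f}"

definition L1_rep :: "('a \<Rightarrow> real) set \<Rightarrow> 'a \<Rightarrow> real" where
  "L1_rep u = (SOME f. f \<in> u)"

definition L1_add :: "'a measure \<Rightarrow> ('a \<Rightarrow> real) set \<Rightarrow> ('a \<Rightarrow> real) set \<Rightarrow> ('a \<Rightarrow> real) set" where
  "L1_add M u v = L1_class M (\<lambda>x. L1_rep u x + L1_rep v x)"

definition L1_diff :: "'a measure \<Rightarrow> ('a \<Rightarrow> real) set \<Rightarrow> ('a \<Rightarrow> real) set \<Rightarrow> ('a \<Rightarrow> real) set" where
  "L1_diff M u v = L1_class M (\<lambda>x. L1_rep u x - L1_rep v x)"

definition L1_scale :: "'a measure \<Rightarrow> real \<Rightarrow> ('a \<Rightarrow> real) set \<Rightarrow> ('a \<Rightarrow> real) set" where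
  "L1_scale M c u = L1_class M (\<lambda>x. c * L1_rep u x)"

definition L1_norm :: "'a measure \<Rightarrow> ('a \<Rightarrow> real) set \<Rightarrow> real" where
  "L1_norm M u = (\<integral>x. \<bar>L1_rep u x\<bar> \<partial>M)"

definition L1_set_integral :: "'a measure \<Rightarrow> 'a set \<Rightarrow> ('a \<Rightarrow> real) set \<Rightarrow> real" where
  "L1_set_integral M A u = set_lebesgue_integral M A (L1_rep u)"

lemma equiv_ae_rel: "equiv {f. integrable M f} (ae_rel M)"
  unfolding ae_rel_def
  by (rule equivI) (auto simp: refl_on_def sym_def intro!: transI)

lemma L1_class_in_L1: "integrable M f \<Longrightarrow> L1_class M f \<in> L1 M"
  unfolding L1_def L1_class_def by (auto intro: quotientI)

lemma L1_class_eq_iff: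
  assumes "integrable M f" and "integrable M g"
  shows "L1_class M f = L1_class M g \<longleftrightarrow> (AE x in M. f x = g x)"
  using eq_equiv_class_iff[OF equiv_ae_rel, of f M g] assms
  by (auto simp: L1_class_def ae_rel_def)

lemma L1_rep_class:
  assumes "integrable M f"
  shows "integrable M (L1_rep (L1_class M f))" and "AE x in M. L1_rep (L1_class M f) x = f x"
proof -
  have "f \<in> L1_class M f"
    using assms by (auto simp: L1_class_def ae_rel_def)
  then have "L1_rep (L1_class M f) \<in> L1_class M f"
    unfolding L1_rep_def by (rule someI[where P = "\<lambda>g. g \<in> L1_class M f"])
  then show "integrable M (L1_rep (L1_class M f))" "AE x in M. L1_rep (L1_class M f) x = f x"
    by (auto simp: L1_class_def ae_rel_def)
qed

lemma L1_add_class: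
  assumes "integrable M f" and "integrable M g"
  shows "L1_add M (L1_class M f) (L1_class M g) = L1_class M (\<lambda>x. f x + g x)"
  unfolding L1_add_def using L1_rep_class[OF assms(1)] L1_rep_class[OF assms(2)] assms
  by (subst L1_class_eq_iff) auto

lemma L1_diff_class:
  assumes "integrable M f" and "integrable M g"
  shows "L1_diff M (L1_class M f) (L1_class M g) = L1_class M (\<lambda>x. f x - g x)"
  unfolding L1_diff_def using L1_rep_class[OF assms(1)] L1_rep_class[OF assms(2)] assms
  by (subst L1_class_eq_iff) auto

lemma L1_scale_class:
  assumes "integrable M f"
  shows "L1_scale M c (L1_class M f) = L1_class M (\<lambda>x. c * f x)"
  unfolding L1_scale_def using L1_rep_class[OF assms] assms
  by (subst L1_class_eq_iff) auto

lemma L1_norm_class: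
  assumes "integrable M f"
  shows "L1_norm M (L1_class M f) = (\<integral>x. \<bar>f x\<bar> \<partial>M)"
  unfolding L1_norm_def using L1_rep_class[OF assms] assms
  by (intro integral_cong_AE) auto

lemma L1_set_integral_class:
  assumes "integrable M f" and "A \<in> sets M"
  shows "L1_set_integral M A (L1_class M f) = set_lebesgue_integral M A f"
  unfolding L1_set_integral_def set_lebesgue_integral_def
  using L1_rep_class[OF assms(1)] assms
  by (intro integral_cong_AE) auto

section \<open>Operators on $L^1$\<close>

text \<open>
  An operator on $L^1$ is a function on classes of which only the values on \<open>L1 M\<close> matter.
\<close>

definition L1_bounded_linear ::
    "'a measure \<Rightarrow> (('a \<Rightarrow> real) set \<Rightarrow> ('a \<Rightarrow> real) set) \<Rightarrow> bool" where
  "L1_bounded_linear M T \<longleftrightarrow>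
     (\<forall>u\<in>L1 M. T u \<in> L1 M) \<and>
     (\<forall>u\<in>L1 M. \<forall>v\<in>L1 M. T (L1_add M u v) = L1_add M (T u) (T v)) \<and>
     (\<forall>c. \<forall>u\<in>L1 M. T (L1_scale M c u) = L1_scale M c (T u)) \<and>
     (\<exists>K. \<forall>u\<in>L1 M. L1_norm M (T u) \<le> K * L1_norm M u)"

text \<open>As for \<^const>\<open>onorm\<close>, the zero vector contributes \<open>0 / 0 = 0\<close>.\<close>

definition L1_onorm ::
    "'a measure \<Rightarrow> (('a \<Rightarrow> real) set \<Rightarrow> ('a \<Rightarrow> real) set) \<Rightarrow> real" where
  "L1_onorm M T = (SUP u\<in>L1 M. L1_norm M (T u) / L1_norm M u)"

definition L1_onorm_convergent ::
    "'a measure \<Rightarrow> real set \<Rightarrow> (real \<Rightarrow> ('a \<Rightarrow> real) set \<Rightarrow> ('a \<Rightarrow> real) set) \<Rightarrow> bool" where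
  "L1_onorm_convergent M J T \<longleftrightarrow>
     (\<exists>S. L1_bounded_linear M S \<and>
          ((\<lambda>t. L1_onorm M (\<lambda>u. L1_diff M (T t u) (S u))) \<longlongrightarrow> 0) (inf at_top (principal J)))"

text \<open>
  These conditions determine \<open>T\<close> uniquely on \<open>L1 M\<close>, see \<open>frobenius_perron_unique\<close> below;
  non-singularity of \<open>\<phi>\<close> is what makes such a \<open>T\<close> exist.
\<close>

definition frobenius_perron ::
    "'a measure \<Rightarrow> ('a \<Rightarrow> 'a) \<Rightarrow> (('a \<Rightarrow> real) set \<Rightarrow> ('a \<Rightarrow> real) set) \<Rightarrow> bool" where
  "frobenius_perron M \<phi> T \<longleftrightarrow>
     L1_bounded_linear M T \<and>
     (\<forall>u\<in>L1 M. \<forall>A\<in>sets M.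
        L1_set_integral M A (T u) = L1_set_integral M (\<phi> -` A \<inter> space M) u)"

lemma L1_cases:
  assumes "u \<in> L1 M"
  obtains f where "integrable M f" and "u = L1_class M f"
  using assms by (auto simp: L1_def L1_class_def elim: quotientE)

lemma frobenius_perron_unique:
  assumes "frobenius_perron M \<phi> T" and "frobenius_perron M \<phi> T'" and u: "u \<in> L1 M"
  shows "T u = T' u"
proof -
  have "T u \<in> L1 M" "T' u \<in> L1 M"
    using assms by (auto simp: frobenius_perron_def L1_bounded_linear_def)
  then obtain f g where f: "integrable M f" "T u = L1_class M f"
    and g: "integrable M g" "T' u = L1_class M g"
    by (metis L1_cases)
  have "set_lebesgue_integral M A f = set_lebesgue_integral M A g" if "A \<in> sets M" for A
  proof -
    have "L1_set_integral M A (T u) = L1_set_integral M A (T' u)"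
      using assms that by (simp add: frobenius_perron_def)
    then show ?thesis
      using f g that by (simp add: L1_set_integral_class)
  qed
  then have "AE x in M. f x = g x"
    using f g by (intro density_unique_real) auto
  then show ?thesis
    using f g by (simp add: L1_class_eq_iff)
qed

definition measure_preserving_map :: "'a measure \<Rightarrow> ('a \<Rightarrow> 'a) \<Rightarrow> bool" where
  "measure_preserving_map M \<phi> \<longleftrightarrow>
     \<phi> \<in> measurable M M \<and> (\<forall>A\<in>sets M. emeasure M (\<phi> -` A \<inter> space M) = emeasure M A)"

end

theory Submission
  imports Defs
begin

text \<open>
  Norm convergence forces \<open>\<parallel>T t - T (t + s)\<parallel> < 1\<close> for fixed \<open>s\<close> and large \<open>t\<close>.  By duality the
  functions \<open>1\<^bsub>\<phi>\<^sub>t\<^sup>-\<^sup>1A\<^esub>\<close> and \<open>1\<^bsub>\<phi>\<^sub>t\<^sub>+\<^sub>s\<^sup>-\<^sup>1A\<^esub>\<close> then have distance less than 1 in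
  $L^\infty$; as they only take the values 0 and 1, they agree almost everywhere.  So
  \<open>\<phi>\<^sub>t\<^sup>-\<^sup>1A\<close> and \<open>\<phi>\<^sub>t\<^sub>+\<^sub>s\<^sup>-\<^sup>1A = \<phi>\<^sub>t\<^sup>-\<^sup>1(\<phi>\<^sub>s\<^sup>-\<^sup>1A)\<close> agree up to a null set, and since \<open>\<phi>\<^sub>t\<close> preserves
  the measure, already \<open>A\<close> and \<open>\<phi>\<^sub>s\<^sup>-\<^sup>1A\<close> do (\<open>AE_invariant_if_preimage_diff_null\<close>).  But then the identity
  satisfies the equation that determines the Frobenius-Perron operator of \<open>\<phi>\<^sub>s\<close>
  (\<open>frobenius_perron_id\<close>), whence \<open>T s = id\<close> by uniqueness.

  For the duality argument it suffices to test the operators on one indicator function, that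
  of the set \<open>\<phi>\<^sub>t\<^sup>-\<^sup>1A - \<phi>\<^sub>t\<^sub>+\<^sub>s\<^sup>-\<^sup>1A\<close> (\<open>null_set_if_onorm_diff_small\<close>).
\<close>

lemma L1_norm_diff_commute:
  assumes "u \<in> L1 M" and "v \<in> L1 M"
  shows "L1_norm M (L1_diff M u v) = L1_norm M (L1_diff M v u)"
proof -
  obtain f g where "integrable M f" "u = L1_class M f" "integrable M g" "v = L1_class M g"
    using assms by (metis L1_cases)
  then show ?thesis
    by (simp add: L1_diff_class L1_norm_class abs_minus_commute)
qed

lemma L1_norm_nonneg: "0 \<le> L1_norm M u"
  by (simp add: L1_norm_def)

lemma L1_norm_diff_le:
  assumes "u \<in> L1 M" and "v \<in> L1 M"
  shows "L1_norm M (L1_diff M u v) \<le> L1_norm M u + L1_norm M v"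
proof -
  obtain f g where f: "integrable M f" "u = L1_class M f" and g: "integrable M g" "v = L1_class M g"
    using assms by (metis L1_cases)
  have "(\<integral>x. \<bar>f x - g x\<bar> \<partial>M) \<le> (\<integral>x. \<bar>f x\<bar> + \<bar>g x\<bar> \<partial>M)"
    using f g by (intro integral_mono) auto
  then show ?thesis
    using f g by (simp add: L1_diff_class L1_norm_class)
qed

lemma L1_norm_diff_le_onorm:
  assumes T: "L1_bounded_linear M T" and S: "L1_bounded_linear M S" and u: "u \<in> L1 M"
  shows "L1_norm M (L1_diff M (T u) (S u))
    \<le> L1_onorm M (\<lambda>u. L1_diff M (T u) (S u)) * L1_norm M u"
proof -
  let ?D = "\<lambda>u. L1_diff M (T u) (S u)"
  obtain K L where K: "\<forall>v\<in>L1 M. L1_norm M (T v) \<le> K * L1_norm M v"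
    and L: "\<forall>v\<in>L1 M. L1_norm M (S v) \<le> L * L1_norm M v"
    using T S by (auto simp: L1_bounded_linear_def)
  have bound: "L1_norm M (?D v) \<le> (K + L) * L1_norm M v" if "v \<in> L1 M" for v
  proof -
    have "T v \<in> L1 M" and "S v \<in> L1 M"
      using T S that by (auto simp: L1_bounded_linear_def)
    then show ?thesis
      using L1_norm_diff_le[of "T v" M "S v"] K L that by (fastforce simp: distrib_right)
  qed
  show ?thesis
  proof (cases "L1_norm M u = 0")
    case True
    then show ?thesis
      using bound[OF u] by simp
  next
    case False
    have "L1_norm M (?D v) / L1_norm M v \<le> max 0 (K + L)" if "v \<in> L1 M" for v
    proof (cases "L1_norm M v = 0")
      case False
      then have "L1_norm M (?D v) / L1_norm M v \<le> K + L"
        using bound[OF that] L1_norm_nonneg[of M v] by (simp add: divide_le_eq)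
      then show ?thesis
        by simp
    qed simp
    then have "bdd_above ((\<lambda>v. L1_norm M (?D v) / L1_norm M v) ` L1 M)"
      by (auto intro!: bdd_aboveI)
    then have "L1_norm M (?D u) / L1_norm M u \<le> L1_onorm M ?D"
      unfolding L1_onorm_def using u by (intro cSUP_upper)
    then show ?thesis
      using False L1_norm_nonneg[of M u] by (simp add: divide_simps split: if_splits)
  qed
qed

lemma L1_set_integral_diff_le_norm:
  assumes "u \<in> L1 M" and "v \<in> L1 M" and A: "A \<in> sets M"
  shows "L1_set_integral M A u - L1_set_integral M A v \<le> L1_norm M (L1_diff M u v)"
proof -
  obtain f g where f: "integrable M f" "u = L1_class M f" and g: "integrable M g" "v = L1_class M g"
    using assms by (metis L1_cases)
  have "(\<integral>x. indicator A x *\<^sub>R f x \<partial>M) - (\<integral>x. indicator A x *\<^sub>R g x \<partial>M)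
    = (\<integral>x. indicator A x *\<^sub>R (f x - g x) \<partial>M)"
    using integrable_mult_indicator[OF A f(1)] integrable_mult_indicator[OF A g(1)]
    by (simp only: Bochner_Integration.integral_diff[symmetric] scaleR_diff_right)
  also have "\<dots> \<le> (\<integral>x. \<bar>f x - g x\<bar> \<partial>M)"
    using f g A by (intro integral_mono integrable_mult_indicator) (auto simp: indicator_def)
  finally show ?thesis
    using f g A by (simp add: L1_diff_class L1_norm_class L1_set_integral_class
        set_lebesgue_integral_def)
qed

text \<open>
  Test both operators on the indicator of \<open>D = \<phi>\<^sup>-\<^sup>1A - \<psi>\<^sup>-\<^sup>1A\<close>.  Integrated over \<open>A\<close>, its images
  differ by \<open>\<mu>(D)\<close>, which is its full norm; operators that are less than 1 apart in norm
  allow this only if the norm is 0.  The reference operator \<open>S\<close> is the limit in the application.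
\<close>

lemma null_set_if_onorm_diff_small:
  assumes "finite_measure M"
    and \<phi>: "\<phi> \<in> measurable M M" and \<psi>: "\<psi> \<in> measurable M M"
    and T: "frobenius_perron M \<phi> T" and U: "frobenius_perron M \<psi> U"
    and S: "L1_bounded_linear M S"
    and less: "L1_onorm M (\<lambda>u. L1_diff M (T u) (S u)) + L1_onorm M (\<lambda>u. L1_diff M (U u) (S u)) < 1"
    and A: "A \<in> sets M"
  shows "measure M (\<phi> -` A \<inter> space M - \<psi> -` A \<inter> space M) = 0"
proof -
  interpret finite_measure M by fact
  define P where "P = \<phi> -` A \<inter> space M"
  define Q where "Q = \<psi> -` A \<inter> space M"
  have sets: "P \<in> sets M" "Q \<in> sets M"
    using A \<phi> \<psi> by (auto simp: P_def Q_def intro: measurable_sets)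
  define f :: "'a \<Rightarrow> real" where "f = indicator (P - Q)"
  define u where "u = L1_class M f"
  have f: "integrable M f"
    using sets by (auto simp: f_def less_top[symmetric] intro!: integrable_real_indicator)
  then have u: "u \<in> L1 M"
    by (simp add: u_def L1_class_in_L1)
  then have Tu: "T u \<in> L1 M" and Uu: "U u \<in> L1 M" and Su: "S u \<in> L1 M"
    and T_lin: "L1_bounded_linear M T" and U_lin: "L1_bounded_linear M U"
    using T U S by (auto simp: frobenius_perron_def L1_bounded_linear_def)
  have norm: "L1_norm M u = measure M (P - Q)"
    using f sets by (simp add: u_def L1_norm_class) (simp add: f_def)
  have "L1_set_integral M P u = measure M (P - Q)"
  proof -
    have "L1_set_integral M P u = (\<integral>x. indicator (P - Q) x \<partial>M)"
      using f sets unfolding u_def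
      by (simp only: L1_set_integral_class set_lebesgue_integral_def)
        (intro Bochner_Integration.integral_cong, auto simp: f_def indicator_def)
    then show ?thesis
      using sets by simp
  qed
  moreover have "L1_set_integral M Q u = 0"
  proof -
    have "L1_set_integral M Q u = (\<integral>x. 0 \<partial>M)"
      using f sets unfolding u_def
      by (simp only: L1_set_integral_class set_lebesgue_integral_def)
        (intro Bochner_Integration.integral_cong, auto simp: f_def indicator_def)
    then show ?thesis
      by simp
  qed
  moreover have "L1_set_integral M P u = L1_set_integral M A (T u)"
    and "L1_set_integral M Q u = L1_set_integral M A (U u)"
    using T U u A by (simp_all add: frobenius_perron_def P_def Q_def)
  ultimately have "measure M (P - Q)
    = (L1_set_integral M A (T u) - L1_set_integral M A (S u))
      + (L1_set_integral M A (S u) - L1_set_integral M A (U u))"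
    by simp
  also have "\<dots> \<le> L1_norm M (L1_diff M (T u) (S u)) + L1_norm M (L1_diff M (U u) (S u))"
  proof (intro add_mono)
    show "L1_set_integral M A (S u) - L1_set_integral M A (U u) \<le> L1_norm M (L1_diff M (U u) (S u))"
      using L1_set_integral_diff_le_norm[OF Su Uu A] L1_norm_diff_commute[OF Su Uu] by simp
  qed (rule L1_set_integral_diff_le_norm[OF Tu Su A])
  also have "\<dots> \<le> (L1_onorm M (\<lambda>u. L1_diff M (T u) (S u)) + L1_onorm M (\<lambda>u. L1_diff M (U u) (S u)))
      * measure M (P - Q)"
    using L1_norm_diff_le_onorm[OF T_lin S u] L1_norm_diff_le_onorm[OF U_lin S u]
    by (simp add: norm distrib_right)
  finally have "measure M (P - Q) \<le> (L1_onorm M (\<lambda>u. L1_diff M (T u) (S u))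
      + L1_onorm M (\<lambda>u. L1_diff M (U u) (S u))) * measure M (P - Q)" .
  then have "measure M (P - Q) \<le> 0"
    using less measure_nonneg[of M "P - Q"]
    by (smt (verit) mult_less_cancel_right2)
  then show ?thesis
    unfolding P_def Q_def by (intro antisym measure_nonneg)
qed

text \<open>
  The set in the last hypothesis is the preimage under \<open>\<phi>\<close> of \<open>A - \<psi>\<^sup>-\<^sup>1A\<close>, so \<open>\<phi>\<close> can be
  cancelled because it is applied first; in the semigroup this is \<open>\<phi>\<^sub>t\<^sub>+\<^sub>s = \<phi>\<^sub>s \<circ> \<phi>\<^sub>t\<close>.
  In a finite measure space the inclusion of \<open>A\<close> in \<open>\<psi>\<^sup>-\<^sup>1A\<close> up to a null set is an
  equality, since both sets have the same measure.
\<close>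

lemma AE_invariant_if_preimage_diff_null:
  assumes "finite_measure M"
    and \<phi>: "measure_preserving_map M \<phi>" and \<psi>: "measure_preserving_map M \<psi>"
    and A: "A \<in> sets M"
    and null: "measure M (\<phi> -` A \<inter> space M - (\<lambda>x. \<psi> (\<phi> x)) -` A \<inter> space M) = 0"
  shows "AE x in M. \<psi> x \<in> A \<longleftrightarrow> x \<in> A"
proof -
  interpret finite_measure M by fact
  define B where "B = \<psi> -` A \<inter> space M"
  have B: "B \<in> sets M"
    using A \<psi> by (auto simp: B_def measure_preserving_map_def intro: measurable_sets)
  have meas_B: "measure M B = measure M A"
    using \<psi> A by (simp add: B_def measure_preserving_map_def measure_def)
  have "\<phi> -` (A - B) \<inter> space M = \<phi> -` A \<inter> space M - (\<lambda>x. \<psi> (\<phi> x)) -` A \<inter> space M"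
    using \<phi> by (auto simp: B_def measure_preserving_map_def dest: measurable_space)
  then have "measure M (A - B) = 0"
    using null \<phi> sets.Diff[OF A B] by (metis measure_def measure_preserving_map_def)
  moreover have "measure M (B - A) = measure M (A - B)"
    using finite_measure_Diff'[OF A B] finite_measure_Diff'[OF B A] meas_B
    by (simp add: Int_commute)
  ultimately have "A - B \<in> null_sets M" "B - A \<in> null_sets M"
    using A B by (auto simp: null_sets_def emeasure_eq_measure)
  then have "AE x in M. x \<notin> A - B" "AE x in M. x \<notin> B - A"
    by (simp_all only: AE_not_in)
  then show ?thesis
    using AE_space by eventually_elim (auto simp: B_def)
qed

lemma frobenius_perron_id:
  assumes \<phi>: "\<phi> \<in> measurable M M"
    and inv: "\<And>A. A \<in> sets M \<Longrightarrow> AE x in M. \<phi> x \<in> A \<longleftrightarrow> x \<in> A"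
  shows "frobenius_perron M \<phi> (\<lambda>u. u)"
proof -
  have "L1_set_integral M A u = L1_set_integral M (\<phi> -` A \<inter> space M) u"
    if "u \<in> L1 M" and A: "A \<in> sets M" for u A
  proof -
    obtain f where f: "integrable M f" "u = L1_class M f"
      using \<open>u \<in> L1 M\<close> by (metis L1_cases)
    have P: "\<phi> -` A \<inter> space M \<in> sets M"
      using \<phi> A by (rule measurable_sets)
    have "AE x in M. indicator A x *\<^sub>R f x = indicator (\<phi> -` A \<inter> space M) x *\<^sub>R f x"
      using inv[OF A] AE_space by eventually_elim (auto simp: indicator_def)
    then have "set_lebesgue_integral M A f = set_lebesgue_integral M (\<phi> -` A \<inter> space M) f"
      unfolding set_lebesgue_integral_def using f A P by (intro integral_cong_AE) auto
    then show ?thesis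
      using f A P by (simp add: L1_set_integral_class)
  qed
  moreover have "L1_bounded_linear M (\<lambda>u. u)"
    by (auto simp: L1_bounded_linear_def intro: exI[of _ 1])
  ultimately show ?thesis
    by (auto simp: frobenius_perron_def)
qed

theorem corollary5p8:
  fixes M :: "'a measure"
    and J :: "real set"
    and \<phi> :: "real \<Rightarrow> 'a \<Rightarrow> 'a"
    and T :: "real \<Rightarrow> ('a \<Rightarrow> real) set \<Rightarrow> ('a \<Rightarrow> real) set"
  assumes "finite_measure M"
    and "J = real ` {1..} \<or> J = {0<..}"
    and "\<And>t. t \<in> J \<Longrightarrow> measure_preserving_map M (\<phi> t)"
    and "\<And>t s x. t \<in> J \<Longrightarrow> s \<in> J \<Longrightarrow> x \<in> space M \<Longrightarrow> \<phi> (t + s) x = (\<phi> t \<circ> \<phi> s) x"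
    and "\<And>t. t \<in> J \<Longrightarrow> frobenius_perron M (\<phi> t) (T t)"
    and "L1_onorm_convergent M J T"
  shows "\<forall>t\<in>J. \<forall>u\<in>L1 M. T t u = u"
proof (intro ballI)
  fix s u
  assume s: "s \<in> J" and u: "u \<in> L1 M"
  obtain S where S: "L1_bounded_linear M S"
    and lim: "((\<lambda>t. L1_onorm M (\<lambda>u. L1_diff M (T t u) (S u))) \<longlongrightarrow> 0) (inf at_top (principal J))"
    using assms(6) by (auto simp: L1_onorm_convergent_def)
  have "eventually (\<lambda>t. L1_onorm M (\<lambda>u. L1_diff M (T t u) (S u)) < 1/2) (inf at_top (principal J))"
    using lim by (rule order_tendstoD) simp
  then obtain N where N: "\<And>t. t \<ge> N \<Longrightarrow> t \<in> J \<Longrightarrow> L1_onorm M (\<lambda>u. L1_diff M (T t u) (S u)) < 1/2"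
    by (auto simp: eventually_inf_principal eventually_at_top_linorder)
  \<comment> \<open>A positive integer lies in \<open>J\<close> in either case.\<close>
  define t where "t = real (max 1 (nat \<lceil>N\<rceil>))"
  have t: "t \<in> J" "t \<ge> N"
    using assms(2) by (auto simp: t_def max_def) linarith+
  have ts: "t + s \<in> J"
    using assms(2)
  proof
    assume J: "J = real ` {1..}"
    then obtain m n where "t = real m" "s = real n" "m \<ge> 1"
      using t(1) s by auto
    then show ?thesis
      unfolding J by (intro image_eqI[of _ _ "m + n"]) auto
  qed (use t s in auto)
  have "s > 0"
    using assms(2) s by auto
  then have small: "L1_onorm M (\<lambda>u. L1_diff M (T t u) (S u))
      + L1_onorm M (\<lambda>u. L1_diff M (T (t + s) u) (S u)) < 1"
    using N[OF t(2,1)] N[OF _ ts] t(2) by simp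
  have meas: "\<phi> r \<in> measurable M M" if "r \<in> J" for r
    using assms(3)[OF that] by (simp add: measure_preserving_map_def)
  have "AE x in M. \<phi> s x \<in> A \<longleftrightarrow> x \<in> A" if A: "A \<in> sets M" for A
  proof (rule AE_invariant_if_preimage_diff_null[OF assms(1) assms(3)[OF t(1)] assms(3)[OF s] A])
    have "\<phi> (t + s) x = \<phi> s (\<phi> t x)" if "x \<in> space M" for x
      using assms(4)[OF s t(1) that] by (simp add: add.commute)
    then have "\<phi> (t + s) -` A \<inter> space M = (\<lambda>x. \<phi> s (\<phi> t x)) -` A \<inter> space M"
      by auto
    then show "measure M (\<phi> t -` A \<inter> space M - (\<lambda>x. \<phi> s (\<phi> t x)) -` A \<inter> space M) = 0"
      using null_set_if_onorm_diff_small[OF assms(1) meas[OF t(1)] meas[OF ts]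
          assms(5)[OF t(1)] assms(5)[OF ts] S small A]
      by simp
  qed
  then have "frobenius_perron M (\<phi> s) (\<lambda>u. u)"
    using meas[OF s] by (intro frobenius_perron_id)
  then show "T s u = u"
    using frobenius_perron_unique[OF assms(5)[OF s] _ u] by simp
qed

end
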